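(* Let $P$ be a GPEA. Then: (i) A congruence $\sim$ on $P$ satisfying (C4), (C5$'$) is a Riesz congruence iff every equivalence class is both downward and upward directed. (ii) If $\sim$ is a Riesz congruence on $P$, then $I:=\{i\in P:i\sim 0\}$ is a normal Riesz ideal in $P$. Moreover, $\sim=\sim_I$.
   Context: $P$ is a GPEA (partial operation $\oplus$, constant $0$; partial associativity; if $a\oplus b$ exists there are $c,d$ with $a\oplus b=c\oplus a=b\oplus d$; two-sided cancellation; $0$ neutral; $a\oplus b=0\Rightarrow a=b=0$). Order: $a\le b$ iff $a\oplus c=b$ for some $c$; for $a\le b$, $a/b$ is the unique $c$ with $a\oplus c=b$, and $b\backslash a$ the unique $d$ with $d\oplus a=b$. An ideal is a nonempty down-set closed under existing sums; it is normal iff $a\oplus c=c\oplus b$ implies ($a\in I\Leftrightarrow b\in I$). (R1): if $i\in I$, $a\oplus b$ exists and $i\le a\oplus b$, there are $j,k\in I$ with $j\le a$, $k\le b$, $i\le j\oplus k$. A Riesz ideal is an R1-ideal also satisfying (R2): if $i\in I$, $i\le a$, then (i) if $(a\backslash i)\oplus b$ exists there is $j\in I$, $j\le b$, with $a\oplus(j/b)$ existing, and (ii) if $b\oplus(i/a)$ exists there is $k\in I$, $k\le b$, with $(b\backslash k)\oplus a$ existing. For an ideal $I$, $a\sim_I b$ iff there are $i,j\in I$, $i\le a$, $j\le b$, with $a\backslash i=b\backslash j$. A binary relation $\sim$ is a congruence iff: (C1) equivalence; (C2) $a\oplus b$, $a_1\oplus b_1$ exist, $a\sim a_1$, $b\sim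 b_1$ imply $a\oplus b\sim a_1\oplus b_1$; (C3) if $a\oplus b$ exists, for any $a_1\sim a$ there is $b_1\sim b$ with $a_1\oplus b_1$ existing, and for any $b_2\sim b$ there is $a_2\sim a$ with $a_2\oplus b_2$ existing. (C4): if $a\sim b$ and either $a\oplus a_1\sim b\oplus b_1$ or $a_1\oplus a\sim b_1\oplus b$, then $a_1\sim b_1$. (C5$'$): $a\sim b\oplus c$ implies $a=a_1\oplus a_2$ for some $a_1\sim b$, $a_2\sim c$. A Riesz congruence is a congruence satisfying (C4), (C5$'$) and (CR): if $a\sim b$, there are $c,d$ with $c\le a\le d$, $c\le b\le d$, $a\backslash c\sim b\backslash c\sim0$ and $d\backslash a\sim d\backslash b\sim0$. A subset is upward (downward) directed if any two elements have a common upper (lower) bound in it. *)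

theory Defs
  imports Main
begin

text \<open>
  Generalized pseudo effect algebras whose underlying set is a type. The partial operation is
  option-valued: \<open>a \<oplus> b = None\<close> means that the sum is undefined.
\<close>

text \<open>The equation \<open>assoc\<close> says that if one of the two iterated sums exists, then so does the
  other, and they are equal.\<close>

locale gpea =
  fixes padd :: "'a \<Rightarrow> 'a \<Rightarrow> 'a option" (infixl "\<oplus>" 65)
    and zero :: 'a ("\<zero>")
  assumes assoc: "Option.bind (a \<oplus> b) (\<lambda>s. s \<oplus> c) = Option.bind (b \<oplus> c) (\<lambda>s. a \<oplus> s)"
    and conj: "a \<oplus> b = Some s \<Longrightarrow> \<exists>c d. c \<oplus> a = Some s \<and> b \<oplus> d = Some s"
    and cancel_left: "a \<oplus> b = Some s \<Longrightarrow> a \<oplus> c = Some s \<Longrightarrow> b = c"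
    and cancel_right: "b \<oplus> a = Some s \<Longrightarrow> c \<oplus> a = Some s \<Longrightarrow> b = c"
    and zero_right: "a \<oplus> \<zero> = Some a"
    and zero_left: "\<zero> \<oplus> a = Some a"
    and positive: "a \<oplus> b = Some \<zero> \<Longrightarrow> a = \<zero> \<and> b = \<zero>"
begin

definition le :: "'a \<Rightarrow> 'a \<Rightarrow> bool" (infix "\<preceq>" 50) where
  "a \<preceq> b \<longleftrightarrow> (\<exists>c. a \<oplus> c = Some b)"

text \<open>\<open>ldiff a b\<close> is the residual written \<open>a / b\<close> and \<open>rdiff b a\<close> the one written with a
  backslash (first \<open>b\<close>, then \<open>a\<close>); both are meaningful only if \<open>a \<preceq> b\<close>.\<close>

definition ldiff :: "'a \<Rightarrow> 'a \<Rightarrow> 'a" where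
  "ldiff a b = (THE c. a \<oplus> c = Some b)"

definition rdiff :: "'a \<Rightarrow> 'a \<Rightarrow> 'a" where
  "rdiff b a = (THE d. d \<oplus> a = Some b)"

definition ideal :: "'a set \<Rightarrow> bool" where
  "ideal I \<longleftrightarrow> I \<noteq> {} \<and> (\<forall>a b. b \<in> I \<and> a \<preceq> b \<longrightarrow> a \<in> I)
    \<and> (\<forall>a b s. a \<in> I \<and> b \<in> I \<and> a \<oplus> b = Some s \<longrightarrow> s \<in> I)"

definition normal_ideal :: "'a set \<Rightarrow> bool" where
  "normal_ideal I \<longleftrightarrow> ideal I
    \<and> (\<forall>a b c s. a \<oplus> c = Some s \<and> c \<oplus> b = Some s \<longrightarrow> (a \<in> I \<longleftrightarrow> b \<in> I))"

definition R1 :: "'a set \<Rightarrow> bool" where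
  "R1 I \<longleftrightarrow> (\<forall>i a b s. i \<in> I \<and> a \<oplus> b = Some s \<and> i \<preceq> s \<longrightarrow>
    (\<exists>j k t. j \<in> I \<and> k \<in> I \<and> j \<preceq> a \<and> k \<preceq> b \<and> j \<oplus> k = Some t \<and> i \<preceq> t))"

definition R2 :: "'a set \<Rightarrow> bool" where
  "R2 I \<longleftrightarrow> (\<forall>i a b. i \<in> I \<and> i \<preceq> a \<longrightarrow>
      (rdiff a i \<oplus> b \<noteq> None \<longrightarrow> (\<exists>j. j \<in> I \<and> j \<preceq> b \<and> a \<oplus> ldiff j b \<noteq> None)) \<and>
      (b \<oplus> ldiff i a \<noteq> None \<longrightarrow> (\<exists>k. k \<in> I \<and> k \<preceq> b \<and> rdiff b k \<oplus> a \<noteq> None)))"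

definition riesz_ideal :: "'a set \<Rightarrow> bool" where
  "riesz_ideal I \<longleftrightarrow> ideal I \<and> R1 I \<and> R2 I"

definition ideal_rel :: "'a set \<Rightarrow> ('a \<times> 'a) set" where
  "ideal_rel I = {(a, b). \<exists>i j. i \<in> I \<and> j \<in> I \<and> i \<preceq> a \<and> j \<preceq> b \<and> rdiff a i = rdiff b j}"

definition C2 :: "('a \<times> 'a) set \<Rightarrow> bool" where
  "C2 r \<longleftrightarrow> (\<forall>a b a1 b1 s s1. a \<oplus> b = Some s \<and> a1 \<oplus> b1 = Some s1 \<and>
    (a, a1) \<in> r \<and> (b, b1) \<in> r \<longrightarrow> (s, s1) \<in> r)"

definition C3 :: "('a \<times> 'a) set \<Rightarrow> bool" where
  "C3 r \<longleftrightarrow> (\<forall>a b. a \<oplus> b \<noteq> None \<longrightarrow>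
    (\<forall>a1. (a1, a) \<in> r \<longrightarrow> (\<exists>b1. (b1, b) \<in> r \<and> a1 \<oplus> b1 \<noteq> None)) \<and>
    (\<forall>b2. (b2, b) \<in> r \<longrightarrow> (\<exists>a2. (a2, a) \<in> r \<and> a2 \<oplus> b2 \<noteq> None)))"

definition congruence :: "('a \<times> 'a) set \<Rightarrow> bool" where
  "congruence r \<longleftrightarrow> equiv UNIV r \<and> C2 r \<and> C3 r"

definition C4 :: "('a \<times> 'a) set \<Rightarrow> bool" where
  "C4 r \<longleftrightarrow> (\<forall>a b a1 b1. (a, b) \<in> r \<and>
    ((\<exists>s t. a \<oplus> a1 = Some s \<and> b \<oplus> b1 = Some t \<and> (s, t) \<in> r) \<or>
     (\<exists>s t. a1 \<oplus> a = Some s \<and> b1 \<oplus> b = Some t \<and> (s, t) \<in> r)) \<longrightarrow> (a1, b1) \<in> r)"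

definition C5' :: "('a \<times> 'a) set \<Rightarrow> bool" where
  "C5' r \<longleftrightarrow> (\<forall>a b c s. b \<oplus> c = Some s \<and> (a, s) \<in> r \<longrightarrow>
    (\<exists>a1 a2. a1 \<oplus> a2 = Some a \<and> (a1, b) \<in> r \<and> (a2, c) \<in> r))"

definition CR :: "('a \<times> 'a) set \<Rightarrow> bool" where
  "CR r \<longleftrightarrow> (\<forall>a b. (a, b) \<in> r \<longrightarrow>
    (\<exists>c d. c \<preceq> a \<and> a \<preceq> d \<and> c \<preceq> b \<and> b \<preceq> d \<and>
      (rdiff a c, rdiff b c) \<in> r \<and> (rdiff b c, \<zero>) \<in> r \<and>
      (rdiff d a, rdiff d b) \<in> r \<and> (rdiff d b, \<zero>) \<in> r))"

definition riesz_congruence :: "('a \<times> 'a) set \<Rightarrow> bool" where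
  "riesz_congruence r \<longleftrightarrow> congruence r \<and> C4 r \<and> C5' r \<and> CR r"

definition upward_directed :: "'a set \<Rightarrow> bool" where
  "upward_directed S \<longleftrightarrow> (\<forall>x\<in>S. \<forall>y\<in>S. \<exists>z\<in>S. x \<preceq> z \<and> y \<preceq> z)"

definition downward_directed :: "'a set \<Rightarrow> bool" where
  "downward_directed S \<longleftrightarrow> (\<forall>x\<in>S. \<forall>y\<in>S. \<exists>z\<in>S. z \<preceq> x \<and> z \<preceq> y)"

end

end

theory Submission
  imports Defs
begin

text \<open>
  By (C2) and (C4), \<open>u \<oplus> c \<sim> c\<close> iff \<open>u \<sim> 0\<close> iff \<open>c \<oplus> u \<sim> c\<close>, so (CR) says exactly that
  congruent elements have congruent common bounds. For (R1), let \<open>i \<sim> 0\<close> and \<open>a \<oplus> b = i \<oplus> x\<close>.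
  Then \<open>x \<sim> a \<oplus> b\<close>, and (C5') splits \<open>x = a\<^sub>1 \<oplus> b\<^sub>1\<close>; cancelling a common lower bound of \<open>b\<close> and
  \<open>b\<^sub>1\<close> on the right gives \<open>i \<le> a \<oplus> k\<close> with \<open>k \<le> b\<close>, \<open>k \<sim> 0\<close>. Now move \<open>i\<close> to the other side,
  \<open>a \<oplus> k = a\<^sub>2 \<oplus> i\<close> with \<open>a\<^sub>2 \<sim> a\<close>, and cancel a common lower bound of \<open>a\<close> and \<open>a\<^sub>2\<close> on the left;
  moving \<open>i\<close> avoids replacing it by a conjugate. (R2) follows from (C3) and a common lower bound.
\<close>

section \<open>Rebracketing, order and residuals\<close>

context gpea
begin

text \<open>This and its mirror image extract from the option-valued associativity axiom that the
  other inner sum exists, which is what every later rebracketing needs.\<close>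

lemma assoc_rightE:
  assumes "a \<oplus> b = Some u" "u \<oplus> c = Some s"
  obtains v where "b \<oplus> c = Some v" "a \<oplus> v = Some s"
  using assoc[of a b c] assms by (cases "b \<oplus> c") auto

lemma assoc_leftE:
  assumes "b \<oplus> c = Some v" "a \<oplus> v = Some s"
  obtains u where "a \<oplus> b = Some u" "u \<oplus> c = Some s"
  using assoc[of a b c] assms by (cases "a \<oplus> b") auto

text \<open>Axiom \<open>conj\<close> lets a summand change sides, so left and right divisibility
  give one order, and both residuals are available below an element.\<close>

lemma le_iff_left: "a \<preceq> s \<longleftrightarrow> (\<exists>d. d \<oplus> a = Some s)"
  unfolding le_def using conj by blast

lemma le_addI1: "a \<oplus> b = Some s \<Longrightarrow> a \<preceq> s"
  unfolding le_def by blast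

lemma le_addI2: "a \<oplus> b = Some s \<Longrightarrow> b \<preceq> s"
  unfolding le_iff_left by blast

lemma ldiff_eq: "a \<oplus> c = Some b \<Longrightarrow> ldiff a b = c"
  unfolding ldiff_def by (rule the_equality) (auto intro: cancel_left)

lemma rdiff_eq: "d \<oplus> a = Some b \<Longrightarrow> rdiff b a = d"
  unfolding rdiff_def by (rule the_equality) (auto intro: cancel_right)

lemma rdiff_add: "a \<preceq> b \<Longrightarrow> rdiff b a \<oplus> a = Some b"
  unfolding le_iff_left using rdiff_eq by blast

lemma ldiff_add: "a \<preceq> b \<Longrightarrow> a \<oplus> ldiff a b = Some b"
  unfolding le_def using ldiff_eq by blast

section \<open>Congruences with (C4) and (C5')\<close>

context
  fixes r :: "('a \<times> 'a) set"
  assumes cong: "congruence r" and C4: "C4 r" and C5': "C5' r"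
begin

lemma cong_refl: "(a, a) \<in> r"
  using cong by (auto simp: congruence_def equiv_def refl_on_def)

lemma cong_sym: "(a, b) \<in> r \<Longrightarrow> (b, a) \<in> r"
  using cong by (auto simp: congruence_def equiv_def sym_def)

lemma cong_trans: "(a, b) \<in> r \<Longrightarrow> (b, c) \<in> r \<Longrightarrow> (a, c) \<in> r"
  using cong unfolding congruence_def equiv_def trans_def by blast

lemma cong_add:
  "a \<oplus> b = Some s \<Longrightarrow> a' \<oplus> b' = Some s' \<Longrightarrow> (a, a') \<in> r \<Longrightarrow> (b, b') \<in> r \<Longrightarrow> (s, s') \<in> r"
  using cong unfolding congruence_def C2_def by blast

text \<open>Compare \<open>u \<oplus> c\<close> with \<open>\<zero> \<oplus> c\<close>: (C4) cancels
  the common summand \<open>c\<close>, and (C2) adds it back.\<close>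

lemma cong_add_zero_left: "u \<oplus> c = Some s \<Longrightarrow> (s, c) \<in> r \<longleftrightarrow> (u, \<zero>) \<in> r"
  using C4 cong_add[OF _ zero_left _ cong_refl] cong_refl zero_left unfolding C4_def by blast

lemma cong_add_zero_right: "c \<oplus> u = Some s \<Longrightarrow> (s, c) \<in> r \<longleftrightarrow> (u, \<zero>) \<in> r"
  using C4 cong_add[OF _ zero_right cong_refl] cong_refl zero_right unfolding C4_def by blast

lemma cong_rdiff_zero: "c \<preceq> a \<Longrightarrow> (rdiff a c, \<zero>) \<in> r \<longleftrightarrow> (a, c) \<in> r"
  using cong_add_zero_left rdiff_add by blast

lemma CR_iff_bounds:
  "CR r \<longleftrightarrow> (\<forall>a b. (a, b) \<in> r \<longrightarrow>
    (\<exists>c. (c, a) \<in> r \<and> c \<preceq> a \<and> c \<preceq> b) \<and> (\<exists>d. (d, a) \<in> r \<and> a \<preceq> d \<and> b \<preceq> d))"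
  (is "_ \<longleftrightarrow> ?B")
proof
  assume CR: "CR r"
  show ?B
  proof (intro allI impI)
    fix a b assume "(a, b) \<in> r"
    with CR obtain c d where cd: "c \<preceq> a" "a \<preceq> d" "c \<preceq> b" "b \<preceq> d"
      "(rdiff a c, rdiff b c) \<in> r" "(rdiff b c, \<zero>) \<in> r"
      "(rdiff d a, rdiff d b) \<in> r" "(rdiff d b, \<zero>) \<in> r"
      unfolding CR_def by meson
    have "(rdiff a c, \<zero>) \<in> r" "(rdiff d a, \<zero>) \<in> r"
      using cd cong_trans by blast+
    then have "(c, a) \<in> r" "(d, a) \<in> r"
      using cd cong_rdiff_zero cong_sym by blast+
    then show "(\<exists>c. (c, a) \<in> r \<and> c \<preceq> a \<and> c \<preceq> b) \<and> (\<exists>d. (d, a) \<in> r \<and> a \<preceq> d \<and> b \<preceq> d)"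
      using cd by blast
  qed
next
  assume B: ?B
  show "CR r"
    unfolding CR_def
  proof (intro allI impI)
    fix a b assume ab: "(a, b) \<in> r"
    with B obtain c d where cd: "(c, a) \<in> r" "c \<preceq> a" "c \<preceq> b" "(d, a) \<in> r" "a \<preceq> d" "b \<preceq> d"
      by meson
    \<comment> \<open>The elements \<open>a\<close>, \<open>b\<close>, \<open>c\<close>,
      \<open>d\<close> lie in one class, so each difference is congruent to zero.\<close>
    have "(rdiff a c, \<zero>) \<in> r" "(rdiff b c, \<zero>) \<in> r" "(rdiff d a, \<zero>) \<in> r" "(rdiff d b, \<zero>) \<in> r"
      using cd ab cong_rdiff_zero cong_sym cong_trans by meson+
    then show "\<exists>c d. c \<preceq> a \<and> a \<preceq> d \<and> c \<preceq> b \<and> b \<preceq> d \<and>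
        (rdiff a c, rdiff b c) \<in> r \<and> (rdiff b c, \<zero>) \<in> r \<and>
        (rdiff d a, rdiff d b) \<in> r \<and> (rdiff d b, \<zero>) \<in> r"
      using cd cong_sym cong_trans by meson
  qed
qed

lemma riesz_congruence_iff_directed:
  "riesz_congruence r \<longleftrightarrow> (\<forall>C \<in> UNIV // r. downward_directed C \<and> upward_directed C)"
proof -
  have "riesz_congruence r \<longleftrightarrow> CR r"
    using cong C4 C5' by (simp add: riesz_congruence_def)
  also have "\<dots> \<longleftrightarrow> (\<forall>C \<in> UNIV // r. downward_directed C \<and> upward_directed C)"
  proof
    assume "CR r"
    then have B: "(\<exists>c. (c, x) \<in> r \<and> c \<preceq> x \<and> c \<preceq> y) \<and> (\<exists>d. (d, x) \<in> r \<and> x \<preceq> d \<and> y \<preceq> d)"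
      if "(x, y) \<in> r" for x y
      using that CR_iff_bounds by simp
    show "\<forall>C \<in> UNIV // r. downward_directed C \<and> upward_directed C"
    proof
      fix C assume "C \<in> UNIV // r"
      then obtain p where C: "C = r `` {p}" by (rule quotientE)
      have "(\<exists>c\<in>C. c \<preceq> x \<and> c \<preceq> y) \<and> (\<exists>d\<in>C. x \<preceq> d \<and> y \<preceq> d)" if "x \<in> C" "y \<in> C" for x y
      proof -
        have px: "(p, x) \<in> r" and xy: "(x, y) \<in> r"
          using that cong_sym cong_trans unfolding C by blast+
        then show ?thesis
          using B[OF xy] cong_sym cong_trans unfolding C by blast
      qed
      then show "downward_directed C \<and> upward_directed C"
        unfolding downward_directed_def upward_directed_def by blast
    qed
  next
    assume D: "\<forall>C \<in> UNIV // r. downward_directed C \<and> upward_directed C"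
    show "CR r"
      unfolding CR_iff_bounds
    proof (intro allI impI)
      fix a b assume "(a, b) \<in> r"
      \<comment> \<open>Directedness of the single class of \<open>a\<close> provides both
        bounds.\<close>
      then have "a \<in> r `` {a}" "b \<in> r `` {a}" using cong_refl by auto
      moreover have "downward_directed (r `` {a})" "upward_directed (r `` {a})"
        using D quotientI[of a UNIV r] by auto
      ultimately show "(\<exists>c. (c, a) \<in> r \<and> c \<preceq> a \<and> c \<preceq> b) \<and> (\<exists>d. (d, a) \<in> r \<and> a \<preceq> d \<and> b \<preceq> d)"
        unfolding downward_directed_def upward_directed_def using cong_sym by blast
    qed
  qed
  finally show ?thesis .
qed

text \<open>Down-closure: if \<open>a \<oplus> c \<sim> 0\<close>, then (C5') splits zero into
  summands congruent to \<open>a\<close> and \<open>c\<close>, and positivity makes both zero.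
  Normality: if \<open>a \<oplus> c = c \<oplus> b = s\<close>, then \<open>a \<sim> 0\<close> and
  \<open>b \<sim> 0\<close> are each equivalent to \<open>s \<sim> c\<close>.\<close>

lemma normal_ideal_zero_class: "normal_ideal {i. (i, \<zero>) \<in> r}"
proof -
  have down: "(a, \<zero>) \<in> r" if "(b, \<zero>) \<in> r" "a \<preceq> b" for a b
  proof -
    obtain c where "a \<oplus> c = Some b" using \<open>a \<preceq> b\<close> unfolding le_def by blast
    moreover have "(\<zero>, b) \<in> r" using that cong_sym by blast
    ultimately obtain a1 a2 where "a1 \<oplus> a2 = Some \<zero>" "(a1, a) \<in> r"
      using C5' unfolding C5'_def by blast
    then show ?thesis using positive cong_sym by blast
  qed
  have "ideal {i. (i, \<zero>) \<in> r}"
    using down cong_refl cong_add[OF _ zero_left] unfolding ideal_def by blast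
  moreover have "(a, \<zero>) \<in> r \<longleftrightarrow> (b, \<zero>) \<in> r" if "a \<oplus> c = Some s" "c \<oplus> b = Some s" for a b c s
    using that cong_add_zero_left cong_add_zero_right by blast
  ultimately show ?thesis unfolding normal_ideal_def by blast
qed

section \<open>The zero class of a Riesz congruence\<close>

context
  assumes CR: "CR r"
begin

text \<open>A common lower bound in the class, written as a left summand of both elements. The next
  lemma gives the right-hand form; cancellation on a given side needs the matching one.\<close>

lemma cong_common_left:
  assumes "(a, b) \<in> r"
  obtains c j k where "c \<oplus> j = Some a" "c \<oplus> k = Some b" "(j, \<zero>) \<in> r" "(k, \<zero>) \<in> r"
proof -
  obtain c where c: "(c, a) \<in> r" "c \<preceq> a" "c \<preceq> b"
    using CR assms unfolding CR_iff_bounds by blast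
  then obtain j k where jk: "c \<oplus> j = Some a" "c \<oplus> k = Some b"
    unfolding le_def by blast
  have "(a, c) \<in> r" "(b, c) \<in> r" using c assms cong_sym cong_trans by blast+
  with jk show thesis using that cong_add_zero_right by blast
qed

lemma cong_common_right:
  assumes "(a, b) \<in> r"
  obtains c j k where "j \<oplus> c = Some a" "k \<oplus> c = Some b" "(j, \<zero>) \<in> r" "(k, \<zero>) \<in> r"
proof -
  obtain c where c: "(c, a) \<in> r" "c \<preceq> a" "c \<preceq> b"
    using CR assms unfolding CR_iff_bounds by blast
  then obtain j k where jk: "j \<oplus> c = Some a" "k \<oplus> c = Some b"
    unfolding le_iff_left by blast
  have "(a, c) \<in> r" "(b, c) \<in> r" using c assms cong_sym cong_trans by blast+
  with jk show thesis using that cong_add_zero_left by blast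
qed

lemma R1_zero_class: "R1 {i. (i, \<zero>) \<in> r}"
proof -
  have "\<exists>j k t. (j, \<zero>) \<in> r \<and> (k, \<zero>) \<in> r \<and> j \<preceq> a \<and> k \<preceq> b \<and> j \<oplus> k = Some t \<and> i \<preceq> t"
    if i: "(i, \<zero>) \<in> r" and s: "a \<oplus> b = Some s" and "i \<preceq> s" for i a b s
  proof -
    obtain x where x: "i \<oplus> x = Some s" using \<open>i \<preceq> s\<close> unfolding le_def by blast
    then have "(x, s) \<in> r" using i cong_add_zero_left cong_sym by blast
    with s obtain a1 b1 where ab1: "a1 \<oplus> b1 = Some x" "(a1, a) \<in> r" "(b1, b) \<in> r"
      using C5' unfolding C5'_def by blast
    obtain d k k1 where d: "k1 \<oplus> d = Some b1" "k \<oplus> d = Some b" and k: "(k, \<zero>) \<in> r"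
      using cong_common_right[OF ab1(3)] by blast
    obtain u where u: "a \<oplus> k = Some u" "u \<oplus> d = Some s"
      using assoc_leftE[OF d(2) s] .
    obtain v where v: "a1 \<oplus> k1 = Some v" "v \<oplus> d = Some x"
      using assoc_leftE[OF d(1) ab1(1)] .
    obtain w where w: "i \<oplus> v = Some w" "w \<oplus> d = Some s"
      using assoc_leftE[OF v(2) x] .
    \<comment> \<open>Cancelling \<open>d\<close> in
      \<open>(i \<oplus> v) \<oplus> d = s = (a \<oplus> k) \<oplus> d\<close> leaves
      \<open>i \<oplus> v = a \<oplus> k\<close>.\<close>
    have "w = u" using w(2) u(2) by (rule cancel_right)
    then obtain a2 where a2: "a2 \<oplus> i = Some u"
      using w(1) conj by blast
    have "(a, u) \<in> r" "(u, a2) \<in> r"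
      using u(1) a2 i k cong_add_zero_right cong_sym by blast+
    then have "(a, a2) \<in> r" by (rule cong_trans)
    then obtain c j j2 where c: "c \<oplus> j = Some a" "c \<oplus> j2 = Some a2" and j: "(j, \<zero>) \<in> r"
      using cong_common_left by blast
    obtain t where t: "j \<oplus> k = Some t" "c \<oplus> t = Some u"
      using assoc_rightE[OF c(1) u(1)] .
    obtain t' where t': "j2 \<oplus> i = Some t'" "c \<oplus> t' = Some u"
      using assoc_rightE[OF c(2) a2] .
    \<comment> \<open>Both \<open>c \<oplus> (j2 \<oplus> i)\<close> and
      \<open>c \<oplus> (j \<oplus> k)\<close> equal \<open>u\<close>; cancelling \<open>c\<close>
      exhibits \<open>i\<close> as a right summand of \<open>j \<oplus> k\<close>.\<close>
    have "t' = t" using t'(2) t(2) by (rule cancel_left)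
    then have "i \<preceq> t" using t'(1) le_addI2 by blast
    with j k t(1) c(1) d(2) show ?thesis using le_addI1 le_addI2 by blast
  qed
  then show ?thesis unfolding R1_def by blast
qed

lemma R2_zero_class: "R2 {i. (i, \<zero>) \<in> r}"
proof -
  have "\<exists>j. (j, \<zero>) \<in> r \<and> j \<preceq> b \<and> a \<oplus> ldiff j b \<noteq> None"
    if i: "(i, \<zero>) \<in> r" and "i \<preceq> a" and ex: "rdiff a i \<oplus> b \<noteq> None" for i a b
  proof -
    \<comment> \<open>Hence (C3) may replace \<open>rdiff a i\<close> by \<open>a\<close>, at the
      cost of changing \<open>b\<close> to some \<open>b1\<close> in its class.\<close>
    have "(a, rdiff a i) \<in> r"
      using i rdiff_add[OF \<open>i \<preceq> a\<close>] cong_add_zero_right by blast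
    then obtain b1 s where b1: "(b1, b) \<in> r" "a \<oplus> b1 = Some s"
      using cong ex unfolding congruence_def C3_def by blast
    obtain c j j1 where c: "c \<oplus> j1 = Some b1" "c \<oplus> j = Some b"
      and "(j, \<zero>) \<in> r" using cong_common_left[OF b1(1)] by blast
    \<comment> \<open>Since \<open>c\<close> is a left summand of \<open>b1\<close>, the sum
      \<open>a \<oplus> c\<close> exists. For \<open>c\<close> to be \<open>ldiff j' b\<close>, the
      remainder must stand to its left, so \<open>j\<close> is exchanged for its conjugate
      \<open>j'\<close>, which is again congruent to zero.\<close>
    obtain j' where j': "j' \<oplus> c = Some b" using c(2) conj by blast
    have "(j', \<zero>) \<in> r"
      using c(2) j' \<open>(j, \<zero>) \<in> r\<close> cong_add_zero_left cong_add_zero_right by blast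
    moreover have "a \<oplus> c \<noteq> None" using assoc_leftE[OF c(1) b1(2)] by auto
    ultimately show ?thesis using j' ldiff_eq[OF j'] le_addI1[OF j'] by auto
  qed
  \<comment> \<open>The mirror image: \<open>c\<close> is now a right summand, and the remainder
    \<open>k\<close> moves to its right as \<open>k'\<close>.\<close>
  moreover have "\<exists>k. (k, \<zero>) \<in> r \<and> k \<preceq> b \<and> rdiff b k \<oplus> a \<noteq> None"
    if i: "(i, \<zero>) \<in> r" and "i \<preceq> a" and ex: "b \<oplus> ldiff i a \<noteq> None" for i a b
  proof -
    have "(a, ldiff i a) \<in> r"
      using i ldiff_add[OF \<open>i \<preceq> a\<close>] cong_add_zero_left by blast
    then obtain b1 s where b1: "(b1, b) \<in> r" "b1 \<oplus> a = Some s"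
      using cong ex unfolding congruence_def C3_def by blast
    obtain c k k1 where c: "k1 \<oplus> c = Some b1" "k \<oplus> c = Some b"
      and "(k, \<zero>) \<in> r" using cong_common_right[OF b1(1)] by blast
    obtain k' where k': "c \<oplus> k' = Some b" using c(2) conj by blast
    have "(k', \<zero>) \<in> r"
      using c(2) k' \<open>(k, \<zero>) \<in> r\<close> cong_add_zero_left cong_add_zero_right by blast
    moreover have "c \<oplus> a \<noteq> None" using assoc_rightE[OF c(1) b1(2)] by auto
    ultimately show ?thesis using k' rdiff_eq[OF k'] le_addI2[OF k'] by auto
  qed
  ultimately show ?thesis unfolding R2_def by blast
qed

lemma ideal_rel_zero_class: "ideal_rel {i. (i, \<zero>) \<in> r} = r"
proof (intro set_eqI iffI; clarify)
  fix a b assume "(a, b) \<in> ideal_rel {i. (i, \<zero>) \<in> r}"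
  then obtain i j where ij: "(i, \<zero>) \<in> r" "(j, \<zero>) \<in> r" "i \<preceq> a" "j \<preceq> b" "rdiff a i = rdiff b j"
    unfolding ideal_rel_def by blast
  then have "(a, rdiff a i) \<in> r" "(b, rdiff a i) \<in> r"
    using rdiff_add cong_add_zero_right by metis+
  then show "(a, b) \<in> r" using cong_sym cong_trans by blast
next
  fix a b assume "(a, b) \<in> r"
  \<comment> \<open>The common left summand \<open>c\<close> is the shared difference
    \<open>rdiff a i = rdiff b j\<close>.\<close>
  then obtain c i j where c: "c \<oplus> i = Some a" "c \<oplus> j = Some b" "(i, \<zero>) \<in> r" "(j, \<zero>) \<in> r"
    by (rule cong_common_left)
  then have "i \<preceq> a" "j \<preceq> b" "rdiff a i = rdiff b j"
    using le_addI2 by (blast, blast, simp add: rdiff_eq)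
  then show "(a, b) \<in> ideal_rel {i. (i, \<zero>) \<in> r}"
    using c(3,4) unfolding ideal_rel_def by blast
qed

end

end

end

theorem theorem4p11:
  fixes padd :: "'a \<Rightarrow> 'a \<Rightarrow> 'a option" and zero :: 'a
  assumes "gpea padd zero"
  shows
    "(\<forall>r. gpea.congruence padd r \<and> gpea.C4 padd r \<and> gpea.C5' padd r \<longrightarrow>
        (gpea.riesz_congruence padd zero r \<longleftrightarrow>
          (\<forall>C \<in> UNIV // r. gpea.downward_directed padd C \<and> gpea.upward_directed padd C)))
     \<and> (\<forall>r I. gpea.riesz_congruence padd zero r \<and> I = {i. (i, zero) \<in> r} \<longrightarrow>
        gpea.normal_ideal padd I \<and> gpea.riesz_ideal padd I \<and> r = gpea.ideal_rel padd I)"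
proof -
  interpret gpea padd zero by (fact assms)
  show ?thesis
    using riesz_congruence_iff_directed normal_ideal_zero_class R1_zero_class R2_zero_class
      ideal_rel_zero_class
    by (auto simp: riesz_congruence_def riesz_ideal_def normal_ideal_def)
qed

end
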